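(* Let $d\ge 1$, $A_0,A_1\in\mathbb{R}^{d\times d}$, and integers $\tau\ge 0$, $k\ge 0$. Consider the one-reset dynamics with bridge shift $\delta_\tau$, learned bridge shift $\widehat{\delta}_\tau$, bridge error $e=\widehat{\delta}_\tau-\delta_\tau$, endpoint mean $\mu_k$, and true and learned endpoint energies $E_k$, $\widehat{E}_k$ evaluated at an endpoint representation $\psi(y_f)\in\mathbb{R}^d$, all as defined in the context. Suppose that the energy perturbation identity $$\widehat{E}_k-E_k=\left(\psi(y_f)-\mu_k\right)^\top A_0^k e-\frac12\left\|A_0^k e\right\|^2$$ holds, and that the endpoint satisfies $\left\|\psi(y_f)-\mu_k\right\|\le 1$. Then $$|\widehat{E}_k-E_k|\le \|A_0^k\|\,\|e\|+\frac12\|A_0^k\|^2\|e\|^2 .$$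
   Context: Setting. The target representation at time $s$ is a vector $\psi_s\in\mathbb{R}^d$. Its (mean) dynamics are switched affine: $\psi_{s+1}=A_{\omega_s}\psi_s+\omega_s b_s$, where $\omega_s\in\{0,1\}$ is the mode ($0$ = passive, $1$ = interaction) and $b_s\in\mathbb{R}^d$. One-reset setting: starting from anchor time $t$, the modes are $\omega_{t}=\dots=\omega_{t+\tau-1}=0$ ($\tau$ passive steps), then $\omega_{t+\tau}=1$ (one interaction), then $\omega_{t+\tau+1}=\dots=\omega_{t+\tau+k}=0$ ($k$ passive steps). Bridge shift: $\delta_\tau:=(A_1-A_0)\psi_{t+\tau}+b_{t+\tau}$. Learned bridge shift: an arbitrary vector $\widehat{\delta}_\tau\in\mathbb{R}^d$. Bridge estimation error: $e:=\widehat{\delta}_\tau-\delta_\tau$. Endpoint mean: $\mu_k:=\psi_{t+\tau+1+k}=A_0^{\tau+1+k}\psi_t+A_0^k\delta_\tau$. Learned endpoint mean (the same formula with $\widehat{\delta}_\tau$ in place of $\delta_\tau$): $\widehat{\mu}_k:=A_0^{\tau+1+k}\psi_t+A_0^k\widehat{\delta}_\tau$. Energies: for a fixed endpoint representation $\psi(y_f)\in\mathbb{R}^d$, $E_k:=-\frac12\|\psi(y_f)-\mu_k\|^2+\mathrm{const}$ and $\widehat{E}_k:=-\frac12\|\psi(y_f)-\widehat{\mu}_k\|^2+\mathrm{const}$, with the same real constant in both. $\|\cdot\|$ is the Euclidean norm on vectors and the induced operator norm on matrices. *)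

theory Defs
  imports "HOL-Analysis.Analysis"
begin

(* The operator ^ on real ^ 'n ^ 'n is the entrywise power, since * is the entrywise
   product on finite Cartesian products; hence a separate power with respect to **. *)
primrec mat_pow :: "real ^ 'n ^ 'n \<Rightarrow> nat \<Rightarrow> real ^ 'n ^ 'n" where
  "mat_pow A 0 = mat 1"
| "mat_pow A (Suc m) = A ** mat_pow A m"

definition op_norm :: "real ^ 'n ^ 'n \<Rightarrow> real" where
  "op_norm A = onorm (\<lambda>x. A *v x)"

(* psi' = A_w psi + w b, with mode w in {0, 1}: 0 is passive, 1 is an interaction. *)
definition switched_affine ::
  "real ^ 'n ^ 'n \<Rightarrow> real ^ 'n ^ 'n \<Rightarrow> (nat \<Rightarrow> real ^ 'n) \<Rightarrow> (nat \<Rightarrow> nat) \<Rightarrow> (nat \<Rightarrow> real ^ 'n) \<Rightarrow> bool" where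
  "switched_affine A0 A1 b \<omega> \<psi> \<longleftrightarrow>
     (\<forall>s. \<omega> s \<in> {0, 1} \<and>
          \<psi> (s + 1) = (if \<omega> s = 0 then A0 else A1) *v \<psi> s + real (\<omega> s) *\<^sub>R b s)"

definition one_reset :: "(nat \<Rightarrow> nat) \<Rightarrow> nat \<Rightarrow> nat \<Rightarrow> nat \<Rightarrow> bool" where
  "one_reset \<omega> t \<tau> k \<longleftrightarrow>
     (\<forall>s. t \<le> s \<and> s < t + \<tau> \<longrightarrow> \<omega> s = 0) \<and>
     \<omega> (t + \<tau>) = 1 \<and>
     (\<forall>s. t + \<tau> + 1 \<le> s \<and> s \<le> t + \<tau> + k \<longrightarrow> \<omega> s = 0)"

definition bridge_shift ::
  "real ^ 'n ^ 'n \<Rightarrow> real ^ 'n ^ 'n \<Rightarrow> (nat \<Rightarrow> real ^ 'n) \<Rightarrow> (nat \<Rightarrow> real ^ 'n) \<Rightarrow> nat \<Rightarrow> nat \<Rightarrow> real ^ 'n" where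
  "bridge_shift A0 A1 b \<psi> t \<tau> = (A1 - A0) *v \<psi> (t + \<tau>) + b (t + \<tau>)"

definition endpoint_mean :: "(nat \<Rightarrow> real ^ 'n) \<Rightarrow> nat \<Rightarrow> nat \<Rightarrow> nat \<Rightarrow> real ^ 'n" where
  "endpoint_mean \<psi> t \<tau> k = \<psi> (t + \<tau> + 1 + k)"

(* The closed form of the endpoint mean, with an arbitrary vector in place of the bridge shift. *)
definition shifted_mean ::
  "real ^ 'n ^ 'n \<Rightarrow> (nat \<Rightarrow> real ^ 'n) \<Rightarrow> nat \<Rightarrow> nat \<Rightarrow> nat \<Rightarrow> real ^ 'n \<Rightarrow> real ^ 'n" where
  "shifted_mean A0 \<psi> t \<tau> k \<delta> = mat_pow A0 (\<tau> + 1 + k) *v \<psi> t + mat_pow A0 k *v \<delta>"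

definition energy :: "real \<Rightarrow> real ^ 'n \<Rightarrow> real ^ 'n \<Rightarrow> real" where
  "energy c y \<mu> = - (1 / 2) * (norm (y - \<mu>))\<^sup>2 + c"

lemma passive_run:
  assumes "switched_affine A0 A1 b \<omega> \<psi>" and "\<And>s. t \<le> s \<Longrightarrow> s < t + m \<Longrightarrow> \<omega> s = 0"
  shows "\<psi> (t + m) = mat_pow A0 m *v \<psi> t"
  using assms(2)
proof (induction m)
  case (Suc m)
  have "\<psi> (t + m + 1) = A0 *v \<psi> (t + m)"
    using assms(1) Suc.prems[of "t + m"] unfolding switched_affine_def by simp
  with Suc show ?case by (simp add: matrix_vector_mul_assoc)
qed simp

lemma mat_pow_add: "mat_pow A (m + n) = mat_pow A m ** mat_pow A n"
  by (induction m) (simp_all add: matrix_mul_assoc)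

lemma endpoint_mean_eq_shifted_mean:
  assumes dyn: "switched_affine A0 A1 b \<omega> \<psi>" and reset: "one_reset \<omega> t \<tau> k"
  shows "endpoint_mean \<psi> t \<tau> k = shifted_mean A0 \<psi> t \<tau> k (bridge_shift A0 A1 b \<psi> t \<tau>)"
proof -
  have 1: "\<psi> (t + \<tau>) = mat_pow A0 \<tau> *v \<psi> t"
    using passive_run[OF dyn] reset unfolding one_reset_def by blast
  have "\<psi> (t + \<tau> + 1) = A1 *v \<psi> (t + \<tau>) + b (t + \<tau>)"
    using dyn reset unfolding switched_affine_def one_reset_def by simp
  then have 2: "\<psi> (t + \<tau> + 1) = A0 *v \<psi> (t + \<tau>) + bridge_shift A0 A1 b \<psi> t \<tau>"
    by (simp add: bridge_shift_def matrix_vector_mult_diff_rdistrib)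
  have 3: "\<psi> (t + \<tau> + 1 + k) = mat_pow A0 k *v \<psi> (t + \<tau> + 1)"
    by (rule passive_run[OF dyn]) (use reset in \<open>auto simp: one_reset_def\<close>)
  have "mat_pow A0 (\<tau> + 1 + k) = mat_pow A0 k ** (A0 ** mat_pow A0 \<tau>)"
    using mat_pow_add[of A0 k "Suc \<tau>"] by (simp add: add.commute)
  with 1 2 3 show ?thesis
    by (simp add: endpoint_mean_def shifted_mean_def matrix_vector_right_distrib
        matrix_vector_mul_assoc)
qed

end

theory Submission
  imports Defs
begin

text \<open>With \<open>v = mat_pow A0 k *v e\<close>, the assumed identity writes the energy gap as
  a term linear in \<open>v\<close> minus half of its squared norm. Cauchy-Schwarz and the unit
  bound on the endpoint residual \<open>\<psi>f - \<mu>\<close> control the linear term by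
  \<open>norm v\<close>. The operator norm inequality,
  \<open>norm_matrix_vector_mult_le_op_norm\<close>, then bounds \<open>norm v\<close>, and its
  square bounds the quadratic term.\<close>

lemma norm_matrix_vector_mult_le_op_norm: "norm (A *v x) \<le> op_norm A * norm x"
  unfolding op_norm_def by (rule onorm[OF matrix_vector_mul_bounded_linear])

theorem corollaryA1:
  fixes A0 A1 :: "real ^ 'n ^ 'n"
    and b \<psi> :: "nat \<Rightarrow> real ^ 'n"
    and \<omega> :: "nat \<Rightarrow> nat"
    and t \<tau> k :: nat
    and \<delta> \<delta>hat e \<mu> \<mu>hat \<psi>f :: "real ^ 'n"
    and c E Ehat :: real
  assumes "switched_affine A0 A1 b \<omega> \<psi>"
    and "one_reset \<omega> t \<tau> k"
    and "\<delta> = bridge_shift A0 A1 b \<psi> t \<tau>"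
    and "e = \<delta>hat - \<delta>"
    and "\<mu> = endpoint_mean \<psi> t \<tau> k"
    and "\<mu>hat = shifted_mean A0 \<psi> t \<tau> k \<delta>hat"
    and "E = energy c \<psi>f \<mu>"
    and "Ehat = energy c \<psi>f \<mu>hat"
    and "Ehat - E = (\<psi>f - \<mu>) \<bullet> (mat_pow A0 k *v e) - 1 / 2 * (norm (mat_pow A0 k *v e))\<^sup>2"
    and "norm (\<psi>f - \<mu>) \<le> 1"
  shows "\<bar>Ehat - E\<bar> \<le> op_norm (mat_pow A0 k) * norm e
           + 1 / 2 * (op_norm (mat_pow A0 k))\<^sup>2 * (norm e)\<^sup>2"
proof -
  define v where "v = mat_pow A0 k *v e"
  have v: "norm v \<le> op_norm (mat_pow A0 k) * norm e"
    unfolding v_def by (rule norm_matrix_vector_mult_le_op_norm)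
  have "\<bar>(\<psi>f - \<mu>) \<bullet> v\<bar> \<le> norm (\<psi>f - \<mu>) * norm v"
    by (rule Cauchy_Schwarz_ineq2)
  also have "\<dots> \<le> norm v"
    \<comment> \<open>The residual lies in the unit ball, so its Cauchy-Schwarz factor is at most
      1.\<close>
    using assms(10) by (simp add: mult_left_le_one_le)
  finally have inner: "\<bar>(\<psi>f - \<mu>) \<bullet> v\<bar> \<le> norm v" .
  have "(norm v)\<^sup>2 \<le> (op_norm (mat_pow A0 k))\<^sup>2 * (norm e)\<^sup>2"
    \<comment> \<open>Squaring preserves the bound \<open>v\<close> because its smaller side is a
      norm, hence nonnegative.\<close>
    using power_mono[OF v norm_ge_zero, of 2] by (simp add: power_mult_distrib)
  moreover have "\<bar>Ehat - E\<bar> \<le> \<bar>(\<psi>f - \<mu>) \<bullet> v\<bar> + 1 / 2 * (norm v)\<^sup>2"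
    \<comment> \<open>Triangle inequality: the square is nonnegative, so the subtracted term equals
      minus its own absolute value.\<close>
    unfolding assms(9) v_def[symmetric] using zero_le_power2[of "norm v"] by linarith
  ultimately show ?thesis
    using inner v by linarith
qed

end
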